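(* Let $M:(0,1)\to(0,1)$ be strictly increasing (it maps compliance to cost), $\epsilon\in(0,1)$ and $p_\epsilon:=M(\epsilon)$. Consider the Circa auction described in the context, where the total value $V_i$ stems from the Beta distribution with $\alpha=\beta=2$ on $[0,1]$ and the scaling factor $\lambda_i$ from the Uniform distribution on $[0,1/2]$, with $v_i^d=(1-\lambda_i)V_i$ and $v_i^p=\lambda_iV_i$. Denote by $F_\beta(x)=3x^2-2x^3$ the cumulative distribution function of this Beta distribution on $[0,1]$. Then the optimal (symmetric Nash equilibrium) bid of agents participating in the auction is $b_i^*:=\min\{\hat b_i^*,1\}$, where $$\hat b_i^*=\begin{cases}p_\epsilon+\dfrac{3(v_i^p)^2(p_\epsilon^2-2p_\epsilon+1)}{1-F_\beta(p_\epsilon)} & \text{if } 0\le v_i^p\le\frac{p_\epsilon}{2},\\[2mm] p_\epsilon+\dfrac{8(v_i^p)^2\bigl(6(v_i^p)^2-8v_i^p+3\bigr)+p_\epsilon^3(3p_\epsilon-4)}{8(1-F_\beta(p_\epsilon))} & \text{if } \frac{p_\epsilon}{2}\le v_i^p\le\frac12 ,\end{cases}$$ that is, if every rival $j$ bids $b_j^*$ (given by the same formula in terms of $v_j^p$), then for every participating agent $i$ the bid $b_i^*$ maximizes its expected utility. The utility attained is $$u_i(b_i^*;\boldsymbol b_{-i},v_i^d,v_i^p)=\begin{cases}v_i^d+\dfrac{6(v_i^p)^2(p_\epsilon^2-2p_\epsilon+1)}{1-F_\beta(p_\epsilon)}-b_i^* & \text{if } 0\le v_i^p\le\frac{p_\epsilon}{2},\\[2mm]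 v_i^d+\dfrac{v_i^p\bigl(8(v_i^p)^3-12(v_i^p)^2+6v_i^p+p_\epsilon^2(2p_\epsilon-3)\bigr)}{1-F_\beta(p_\epsilon)}-b_i^* & \text{if } \frac{p_\epsilon}{2}\le v_i^p\le\frac12 .\end{cases}$$ Participating agents submit models with compliance level $$s_i^*=\begin{cases}M^{-1}(b_i^* )>\epsilon & \text{if } u_i(b_i^*;\boldsymbol b_{-i},v_i^d,v_i^p)>0,\\ 0\ \text{(no submission)} & \text{otherwise.}\end{cases}$$
   Context: Circa auction. A regulator fixes a compliance threshold $\epsilon\in(0,1)$. An agent spending (bidding) $b$ obtains a model of compliance level $M^{-1}(b)$; the price of the threshold is $p_\epsilon=M(\epsilon)\in(0,1)$. Each agent $i$ privately and independently draws $V_i$ and $\lambda_i$ (independent of each other) from the distributions in the claim, which are common knowledge; $v_i^d=(1-\lambda_i)V_i$ is its deployment value and $v_i^p=\lambda_iV_i\in[0,1/2]$ its premium value. Agent $i$ chooses a bid $b\in[0,1]$, which is a sunk cost. It is paired with one randomly chosen rival $j$ among participating agents. If $b_j$ is the rival's bid and $\boldsymbol b_{-i}$ denotes the bids of all agents other than $i$, agent $i$'s realized utility is $$u_i(b;\boldsymbol b_{-i},v_i^d,v_i^p)=\begin{cases}-b & \text{if } b<p_\epsilon,\\ v_i^d-b & \text{if } b\ge p_\epsilon \text{ and } b<b_j,\\ v_i^d+v_i^p-b & \text{if } b\ge p_\epsilon\text{ and } b>b_j,\end{cases}$$ and a bid $b=1$ automatically wins, i.e. yields $v_i^d+v_i^p-1$.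 "Utility" of a bid means the expectation of this quantity over the random participating rival and its private values, with agent $i$'s own $v_i^d,v_i^p$ fixed. Bidding $0$ means not participating (no submission, compliance recorded as $0$) and gives utility $0$. An agent participates exactly when some bid gives it strictly positive (expected) utility.
   Formalization: The rival is drawn from agents with total value V_j > p_ε (all bidding b_j^* ), not from those with positive expected utility, for which the formulas fail; M^{-1}(b_i^* ) > ε is claimed only for v_i^p > 0 (≥ ε otherwise) and when b_i^* lies in the range of M. *)

theory Defs
  imports "HOL-Probability.Probability"
begin

definition beta_density :: "real \<Rightarrow> real \<Rightarrow> real \<Rightarrow> real" where
  "beta_density a b x =
     (if x \<in> {0<..<1} then x powr (a - 1) * (1 - x) powr (b - 1) / Beta a b else 0)"

definition beta_distribution :: "real \<Rightarrow> real \<Rightarrow> real measure" where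
  "beta_distribution a b = density lborel (\<lambda>x. ennreal (beta_density a b x))"

definition F_beta :: "real \<Rightarrow> real" where
  "F_beta x = 3 * x^2 - 2 * x^3"

lemma beta_density_2_2: "beta_density 2 2 x = (if x \<in> {0<..<1} then 6 * x * (1 - x) else 0)"
proof -
  have *: "Beta 2 2 = (1/6 :: real)"
    using Gamma_fact[of 1, where ?'a = real] Gamma_fact[of 3, where ?'a = real]
    by (simp add: Beta_def fact_numeral)
  show ?thesis
    unfolding beta_density_def * by auto
qed

lemma cdf_beta_2_2:
  assumes "x \<in> {0..1}"
  shows "cdf (beta_distribution 2 2) x = F_beta x"
proof -
  have "emeasure (beta_distribution 2 2) {..x}
      = (\<integral>\<^sup>+ t. ennreal (beta_density 2 2 t) * indicator {..x} t \<partial>lborel)"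
    unfolding beta_distribution_def
    by (subst emeasure_density) (auto simp: beta_density_2_2[abs_def])
  also have "\<dots> = (\<integral>\<^sup>+ t. ennreal (6 * t * (1 - t)) * indicator {0..x} t \<partial>lborel)"
    using assms by (intro nn_integral_cong) (auto simp: beta_density_2_2 indicator_def)
  also have "\<dots> = ennreal (F_beta x - F_beta 0)"
    using assms
    by (intro nn_integral_FTC_Icc)
       (auto simp: F_beta_def algebra_simps power2_eq_square mult_left_le
             intro!: derivative_eq_intros)
  also have "F_beta 0 = 0"
    by (simp add: F_beta_def)
  finally have "emeasure (beta_distribution 2 2) {..x} = ennreal (F_beta x)"
    by simp
  moreover have "F_beta x = x^2 * (3 - 2 * x)"
    by (simp add: F_beta_def power2_eq_square power3_eq_cube algebra_simps)
  then have "0 \<le> F_beta x"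
    using assms by simp
  ultimately show ?thesis
    by (simp add: cdf_def measure_def)
qed

text \<open>
  An agent's private type is the pair \<open>(V, l)\<close> of its total value and scaling factor; its
  deployment value is \<open>(1 - l) * V\<close> and its premium value is \<open>l * V\<close>.
\<close>

definition types :: "(real \<times> real) set" where
  "types = {0..1} \<times> {0..1/2}"

definition type_law :: "(real \<times> real) measure" where
  "type_law = beta_distribution 2 2 \<Otimes>\<^sub>M uniform_measure lborel {0..1/2}"

text \<open>
  The realized utility of bid \<open>b\<close> against the rival bid \<open>bj\<close>. A tie
  \<open>b = bj\<close> with \<open>p \<le> b < 1\<close> is counted as a loss; this has no effect on
  expected utility, since the rival bids below 1 considered here have no atoms.
\<close>

definition utility :: "real \<Rightarrow> real \<Rightarrow> real \<Rightarrow> real \<Rightarrow> real \<Rightarrow> real" where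
  "utility p vd vp b bj =
     (if b < p then - b
      else if b = 1 \<or> bj < b then vd + vp - b
      else vd - b)"

text \<open>
  The pool of participants from which the rival is drawn: the types for which entering the
  auction can pay at all, that is, for which some bid is profitable against some rival bid.
  By \<open>entrants_eq\<close> these are the types with \<open>V > p\<close>, so conditioning on
  this event is what produces the factor \<open>1 - F_beta p\<close> in the equilibrium bid.
  The pool does not depend on the strategy of the rivals. It is larger than the set of types
  whose expected utility is positive, see \<open>participates\<close> below.
\<close>

definition entrants :: "real \<Rightarrow> (real \<times> real) set" where
  "entrants p = {(V, l) \<in> types.
     \<exists>b\<in>{0..1}. \<exists>bj\<in>{0..1}. utility p ((1 - l) * V) (l * V) b bj > 0}"

lemma entrants_eq:
  assumes "p \<in> {0<..<1}"
  shows "entrants p = {(V, l) \<in> types. p < V}"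
proof -
  have "(\<exists>b\<in>{0..1}. \<exists>bj\<in>{0..1}. utility p ((1 - l) * V) (l * V) b bj > 0) \<longleftrightarrow> p < V"
    if "(V, l) \<in> types" for V l
  proof
    assume "p < V"
    then have "utility p ((1 - l) * V) (l * V) p 0 > 0"
      using assms by (simp add: utility_def algebra_simps)
    then show "\<exists>b\<in>{0..1}. \<exists>bj\<in>{0..1}. utility p ((1 - l) * V) (l * V) b bj > 0"
      using assms by (intro bexI[of _ p] bexI[of _ 0]) auto
  next
    assume "\<exists>b\<in>{0..1}. \<exists>bj\<in>{0..1}. utility p ((1 - l) * V) (l * V) b bj > 0"
    moreover have "0 \<le> l * V"
      using that by (simp add: types_def)
    ultimately show "p < V"
      by (auto simp: utility_def algebra_simps split: if_splits)
  qed
  then show ?thesis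
    unfolding entrants_def by auto
qed

definition rival_law :: "real \<Rightarrow> (real \<times> real) measure" where
  "rival_law p = uniform_measure type_law (entrants p)"

text \<open>A strategy maps deployment value and premium value to a bid.\<close>

type_synonym strategy = "real \<Rightarrow> real \<Rightarrow> real"

definition expected_utility ::
  "real \<Rightarrow> strategy \<Rightarrow> real \<Rightarrow> real \<Rightarrow> real \<Rightarrow> real" where
  "expected_utility p \<sigma> vd vp b =
     (\<integral>(V, l). utility p vd vp b (\<sigma> ((1 - l) * V) (l * V)) \<partial>rival_law p)"

definition participates :: "real \<Rightarrow> strategy \<Rightarrow> real \<Rightarrow> real \<Rightarrow> bool" where
  "participates p \<sigma> vd vp \<longleftrightarrow> (\<exists>b\<in>{0..1}. expected_utility p \<sigma> vd vp b > 0)"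

definition optimal_bid :: "real \<Rightarrow> strategy \<Rightarrow> real \<Rightarrow> real \<Rightarrow> real \<Rightarrow> bool" where
  "optimal_bid p \<sigma> vd vp b \<longleftrightarrow>
     b \<in> {0..1} \<and> (\<forall>b'\<in>{0..1}. expected_utility p \<sigma> vd vp b' \<le> expected_utility p \<sigma> vd vp b)"

definition symmetric_equilibrium :: "real \<Rightarrow> strategy \<Rightarrow> bool" where
  "symmetric_equilibrium p \<sigma> \<longleftrightarrow>
     (\<forall>(V, l)\<in>types. let vd = (1 - l) * V; vp = l * V in
        participates p \<sigma> vd vp \<longrightarrow> optimal_bid p \<sigma> vd vp (\<sigma> vd vp))"

definition bid_hat :: "real \<Rightarrow> real \<Rightarrow> real" where
  "bid_hat p vp =
     (if vp \<le> p / 2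
      then p + 3 * vp^2 * (p^2 - 2 * p + 1) / (1 - F_beta p)
      else p + (8 * vp^2 * (6 * vp^2 - 8 * vp + 3) + p^3 * (3 * p - 4)) / (8 * (1 - F_beta p)))"

lemma bid_hat_boundary:
  "bid_hat p (p / 2) =
     p + (8 * (p/2)^2 * (6 * (p/2)^2 - 8 * (p/2) + 3) + p^3 * (3 * p - 4)) / (8 * (1 - F_beta p))"
proof -
  have "8 * (p/2)^2 * (6 * (p/2)^2 - 8 * (p/2) + 3) + p^3 * (3 * p - 4)
      = 8 * (3 * (p/2)^2 * (p^2 - 2 * p + 1))"
    by (simp add: power2_eq_square power3_eq_cube field_simps)
  then show ?thesis
    unfolding bid_hat_def by (simp only: mult_divide_mult_cancel_left) simp
qed

definition bid_star :: "real \<Rightarrow> strategy" where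
  "bid_star p vd vp = min (bid_hat p vp) 1"

text \<open>
  \<open>compliance_level M b\<close> is the inverse of \<open>M\<close> at \<open>b\<close>; it is
  meaningful only for \<open>b\<close> in the range of \<open>M\<close>. The recorded compliance is 0
  when nothing is submitted, which is the bid 0.
\<close>

definition compliance_level :: "(real \<Rightarrow> real) \<Rightarrow> real \<Rightarrow> real" where
  "compliance_level M b = the_inv_into {0<..<1} M b"

definition recorded_compliance :: "(real \<Rightarrow> real) \<Rightarrow> real \<Rightarrow> real" where
  "recorded_compliance M b = (if b = 0 then 0 else compliance_level M b)"

definition submitted_bid :: "real \<Rightarrow> strategy \<Rightarrow> real \<Rightarrow> real \<Rightarrow> real" where
  "submitted_bid p \<sigma> vd vp = (if participates p \<sigma> vd vp then \<sigma> vd vp else 0)"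

end

theory Submission
  imports Defs
begin

text \<open>
  Conditionally on \<open>V > p\<close> the rival's premium value has distribution function
  \<open>G = premium_cdf p\<close>, and \<open>bid_hat p x\<close> is \<open>p\<close> plus the integral of \<open>t\<close> against \<open>G\<close> over
  \<open>[0, x]\<close>. It is strictly increasing, so bidding as premium value \<open>x\<close> wins with probability
  \<open>G x\<close>, and \<open>y * G x - bid_hat p x\<close> is maximal at \<open>x = y\<close>. Truncating the bid at 1 does
  not disturb this: the bid 1 yields \<open>V - 1 \<le> 0\<close>, so an agent with \<open>bid_hat p y \<ge> 1\<close> does not
  participate, and a participant never gains by jumping to the bid 1.
\<close>

section \<open>Closed forms of the premium distribution and of the bid\<close>

definition premium_cdf :: "real \<Rightarrow> real \<Rightarrow> real" where
  "premium_cdf p x =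
     (F_beta (max p (2 * x)) - F_beta p + 6 * x * (1 - max p (2 * x))^2) / (1 - F_beta p)"

text \<open>The double root at 1 reflects that the density vanishes there; the factored form exposes
  the sign of the denominator shared by all the formulas.\<close>

lemma one_minus_F_beta: "1 - F_beta p = (1 - p)^2 * (1 + 2 * p)"
  by (simp add: F_beta_def power2_eq_square power3_eq_cube algebra_simps)

lemma F_beta_less_one: "p \<in> {0<..<1} \<Longrightarrow> F_beta p < 1"
  using one_minus_F_beta[of p] by (smt (verit) greaterThanLessThan_iff mult_pos_pos zero_less_power)

text \<open>With \<open>a = max p (2 * x)\<close>, the two \<open>F_beta\<close> terms of
  \<open>premium_cdf\<close> weigh the values V in (p, a), where l * V < x is certain, and the third
  is the integral of 12 * x * (1 - V) over [a, 1]. Up to p/2 only the third remains.\<close>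

lemma premium_cdf_le:
  "x \<le> p / 2 \<Longrightarrow> premium_cdf p x = 6 * x * (p^2 - 2 * p + 1) / (1 - F_beta p)"
  by (simp add: premium_cdf_def max_absorb1 power2_diff algebra_simps)

lemma premium_cdf_ge:
  assumes "p / 2 \<le> x"
  shows "premium_cdf p x = (8 * x^3 - 12 * x^2 + 6 * x + p^2 * (2 * p - 3)) / (1 - F_beta p)"
proof -
  have "max p (2 * x) = 2 * x" using assms by simp
  then show ?thesis unfolding premium_cdf_def
    by (simp add: F_beta_def power2_eq_square power3_eq_cube algebra_simps)
qed

lemma bid_hat_le:
  "x \<le> p / 2 \<Longrightarrow> bid_hat p x = p + 3 * x^2 * (p^2 - 2 * p + 1) / (1 - F_beta p)"
  by (simp add: bid_hat_def)

text \<open>The definition assigns x = p/2 to the other branch; \<open>bid_hat_boundary\<close>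
  closes this range too, so that later arguments can glue at p/2.\<close>

lemma bid_hat_ge:
  assumes "p / 2 \<le> x"
  shows "bid_hat p x =
    p + (8 * x^2 * (6 * x^2 - 8 * x + 3) + p^3 * (3 * p - 4)) / (8 * (1 - F_beta p))"
  using assms bid_hat_boundary[of p] by (cases "x = p / 2") (auto simp: bid_hat_def)

lemma premium_cdf_half: "p \<in> {0<..<1} \<Longrightarrow> premium_cdf p (1/2) = 1"
  using F_beta_less_one[of p] by (simp add: premium_cdf_def F_beta_def)

lemma premium_cdf_strict_mono_on:
  assumes p: "p \<in> {0<..<1}"
  shows "strict_mono_on {0..1/2} (premium_cdf p)"
proof -
  have D: "0 < 1 - F_beta p" using F_beta_less_one[OF p] by simp
  have low: "premium_cdf p x < premium_cdf p y" if "x < y" "y \<le> p / 2" for x y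
  proof -
    have "0 < (1 - p)^2" using p by simp
    then have "0 < p^2 - 2 * p + 1" by (simp add: power2_diff algebra_simps)
    then show ?thesis
      using that D by (simp add: premium_cdf_le divide_strict_right_mono)
  qed
  have high: "premium_cdf p x < premium_cdf p y" if "x < y" "p / 2 \<le> x" for x y
  proof -
    \<comment> \<open>Up to a constant the numerator is (2 * x - 1)^3, and s^3 - t^3 = (s - t) * (3
      * (s + t)^2 + (s - t)^2) / 4 for s = 2 * y - 1 and t = 2 * x - 1.\<close>
    have "0 < 2 * (y - x) * (3 * (x + y - 1)^2 + (y - x)^2)"
      using that by (intro mult_pos_pos add_nonneg_pos) auto
    then show ?thesis
      unfolding premium_cdf_ge[OF that(2)] premium_cdf_ge[OF order.trans[OF that(2) less_imp_le[OF that(1)]]]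
      by (intro divide_strict_right_mono[OF _ D])
        (simp add: power2_eq_square power3_eq_cube algebra_simps)
  qed
  show ?thesis
  proof (rule strict_mono_onI)
    fix x y :: real assume "x < y"
    then show "premium_cdf p x < premium_cdf p y"
      using low[of x y] high[of x y] low[of x "p/2"] high[of "p/2" y] by linarith
  qed
qed

text \<open>
  Since \<open>bid_hat p\<close> is \<open>p\<close> plus the integral of \<open>t\<close> against the law \<open>premium_cdf p\<close>, the gap
  between the two sides is the integral of \<open>y - t\<close> against the same law from \<open>x\<close> to \<open>y\<close>, which
  is nonnegative whichever endpoint is larger.
\<close>

lemma bid_hat_tangent:
  assumes p: "p \<in> {0<..<1}" and x: "x \<in> {0..1/2}" and y: "y \<in> {0..1/2}"
  shows "y * premium_cdf p x - bid_hat p x \<le> y * premium_cdf p y - bid_hat p y"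
proof -
  have D: "0 < 1 - F_beta p" using F_beta_less_one[OF p] by simp
  \<comment> \<open>Naming the reciprocal turns the identities below into polynomial ones, in which
    only its sign matters.\<close>
  define c where "c = inverse (1 - F_beta p)"
  have G_le: "premium_cdf p z = 6 * z * (p^2 - 2 * p + 1) * c"
    and B_le: "bid_hat p z = p + 3 * z^2 * (p^2 - 2 * p + 1) * c" if "z \<le> p / 2" for z
    unfolding premium_cdf_le[OF that] bid_hat_le[OF that] c_def
    by (simp_all only: divide_inverse)
  have G_ge: "premium_cdf p z = (8 * z^3 - 12 * z^2 + 6 * z + p^2 * (2 * p - 3)) * c"
    and B_ge: "bid_hat p z = p + (8 * z^2 * (6 * z^2 - 8 * z + 3) + p^3 * (3 * p - 4)) / 8 * c"
    if "p / 2 \<le> z" for z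
    unfolding premium_cdf_ge[OF that] bid_hat_ge[OF that] c_def
    by (simp_all only: divide_inverse inverse_mult_distrib mult.assoc)
  have low: "y * premium_cdf p x - bid_hat p x \<le> y * premium_cdf p y - bid_hat p y"
    if "x \<le> p / 2" "y \<le> p / 2" for x y
  proof -
    \<comment> \<open>In this range the premium density is the constant 6 * (1 - p)^2 * c.\<close>
    have "y * premium_cdf p y - bid_hat p y - (y * premium_cdf p x - bid_hat p x)
        = 3 * (1 - p)^2 * (y - x)^2 * c"
      unfolding G_le[OF that(1)] B_le[OF that(1)] G_le[OF that(2)] B_le[OF that(2)]
      by algebra
    also have "\<dots> \<ge> 0" using D by (simp add: c_def)
    finally show ?thesis by simp
  qed
  have high: "y * premium_cdf p x - bid_hat p x \<le> y * premium_cdf p y - bid_hat p y"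
    if "p / 2 \<le> x" "p / 2 \<le> y" for x y
  proof -
    \<comment> \<open>Here the density is 6 * (1 - 2 * t)^2 * c. With w = 1 - 2 * y and d = y - x
      the integral is d^2 * (3 * w^2 + 8 * w * d + 6 * d^2) * c; the right-hand side completes the
      square.\<close>
    have "y * premium_cdf p y - bid_hat p y - (y * premium_cdf p x - bid_hat p x)
        = (y - x)^2 * (3 * ((1 - 2 * y) + 4/3 * (y - x))^2 + 2/3 * (y - x)^2) * c"
      unfolding G_ge[OF that(1)] B_ge[OF that(1)] G_ge[OF that(2)] B_ge[OF that(2)]
      by (simp add: field_simps) algebra
    also have "\<dots> \<ge> 0" using D by (simp add: c_def)
    finally show ?thesis by simp
  qed
  note mono = strict_mono_onD[OF premium_cdf_strict_mono_on[OF p]]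
  consider "x \<le> p/2" "y \<le> p/2" | "p/2 \<le> x" "p/2 \<le> y" | "x < p/2" "p/2 < y" | "y < p/2" "p/2 < x"
    by linarith
  then show ?thesis
  proof cases
    case 3
    \<comment> \<open>The inequality for premium p/2 on the left and the one for y on the right meet
      at p/2; this product is what is left over when they are added.\<close>
    then have "0 \<le> (y - p/2) * (premium_cdf p (p/2) - premium_cdf p x)"
      using mono[of x "p/2"] p x by simp
    then show ?thesis
      using low[of x "p/2"] high[of "p/2" y] 3 unfolding left_diff_distrib right_diff_distrib by linarith
  next
    case 4
    then have "0 \<le> (p/2 - y) * (premium_cdf p x - premium_cdf p (p/2))"
      using mono[of "p/2" x] p x by simp
    then show ?thesis
      using low[of "p/2" y] high[of x "p/2"] 4 unfolding left_diff_distrib right_diff_distrib by linarith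
  qed (use low high in auto)
qed

lemma bid_hat_0: "p \<in> {0<..<1} \<Longrightarrow> bid_hat p 0 = p"
  by (simp add: bid_hat_def)

lemma bid_hat_strict_mono_on:
  assumes p: "p \<in> {0<..<1}"
  shows "strict_mono_on {0..1/2} (bid_hat p)"
proof (rule strict_mono_onI)
  have pos: "bid_hat p x < bid_hat p y" if "0 < x" "x < y" "y \<le> 1/2" for x y
  proof -
    have "x * premium_cdf p x < x * premium_cdf p y"
      using that strict_mono_onD[OF premium_cdf_strict_mono_on[OF p], of x y] by simp
    moreover have "x * premium_cdf p y - bid_hat p y \<le> x * premium_cdf p x - bid_hat p x"
      using that by (intro bid_hat_tangent[OF p]) auto
    ultimately show ?thesis by linarith
  qed
  fix x y :: real assume xy: "x \<in> {0..1/2}" "y \<in> {0..1/2}" "x < y"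
  \<comment> \<open>At x = 0 that bound is only weak, so the midpoint supplies the
    strictness.\<close>
  have "bid_hat p x \<le> bid_hat p ((x + y) / 2)"
    using xy p bid_hat_tangent[OF p, of "(x + y) / 2" x] pos[of x "(x + y) / 2"]
    by (cases "x = 0") auto
  also have "\<dots> < bid_hat p y" using xy by (intro pos) auto
  finally show "bid_hat p x < bid_hat p y" .
qed

lemma continuous_on_bid_hat:
  assumes p: "p \<in> {0<..<1}"
  shows "continuous_on UNIV (bid_hat p)"
proof -
  have "F_beta p \<noteq> 1" using F_beta_less_one[OF p] by simp
  then have "continuous_on {..p/2} (bid_hat p)" "continuous_on {p/2..} (bid_hat p)"
    by (simp_all add: bid_hat_le bid_hat_ge cong: continuous_on_cong_simp)
       (intro continuous_intros; simp)+
  then have "continuous_on ({..p/2} \<union> {p/2..}) (bid_hat p)"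
    by (intro continuous_on_closed_Un) auto
  moreover have "{..p/2} \<union> {p/2..} = UNIV" by auto
  ultimately show ?thesis by simp
qed

section \<open>The law of the rival's premium value\<close>

lemma F_beta_mono:
  assumes "0 \<le> p" "p \<le> a" "a \<le> 1"
  shows "F_beta p \<le> F_beta a"
proof -
  have "a * a \<le> a" "p * p \<le> p" "a * p \<le> p" "a * p \<le> a"
    using assms by (simp_all add: mult_left_le mult_left_le_one_le)
  then have "0 \<le> 3 * (a + p) - 2 * (a * a + a * p + p * p)"
    unfolding distrib_left by linarith
  then have "0 \<le> (a - p) * (3 * (a + p) - 2 * (a * a + a * p + p * p))"
    using assms by simp
  also have "\<dots> = F_beta a - F_beta p" by (simp add: F_beta_def power2_eq_square power3_eq_cube algebra_simps)
  finally show ?thesis by simp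
qed

lemma sets_type_law [measurable_cong]: "sets type_law = sets (borel \<Otimes>\<^sub>M borel)"
  unfolding type_law_def beta_distribution_def
  by (intro sets_pair_measure_cong) auto

lemma space_type_law: "space type_law = UNIV"
  using sets_eq_imp_space_eq[OF sets_type_law] by (simp add: space_pair_measure)

lemma prob_space_uniform_half: "prob_space (uniform_measure lborel {0..1/2::real})"
  by (rule prob_space_uniform_measure) auto

text \<open>The half-open interval matches the strict inequality l < x / V.\<close>

lemma emeasure_uniform_half:
  assumes "0 \<le> a"
  shows "emeasure (uniform_measure lborel {0..1/2}) {0..<a} = ennreal (min 1 (2 * a))"
proof -
  have "{0..1/2} \<inter> {0..<a} = (if a \<le> 1/2 then {0..<a} else {0..1/2})" by auto
  then have "emeasure (uniform_measure lborel {0..1/2}) {0..<a} = ennreal (min a (1/2)) / ennreal (1/2)"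
    using assms by (auto simp: min_def)
  also have "\<dots> = ennreal (min a (1/2) / (1/2))"
    using assms by (intro divide_ennreal) auto
  also have "min a (1/2) / (1/2) = min 1 (2 * a)" by auto
  finally show ?thesis .
qed

lemma entrants_measurable [measurable]:
  assumes "p \<in> {0<..<1}"
  shows "entrants p \<in> sets (borel \<Otimes>\<^sub>M borel)"
proof -
  have "entrants p = {p<..1} \<times> {0..1/2}"
    using assms unfolding entrants_eq[OF assms] types_def by auto
  then show ?thesis by simp
qed

text \<open>
  For a fixed value \<open>V\<close> in \<open>(p, 1]\<close> the conditional probability of \<open>l * V < x\<close> is
  \<open>min 1 (2 * x / V)\<close>, so the integral splits at \<open>V = 2 * x\<close>.
\<close>

lemma emeasure_entrants_premium:
  assumes p: "p \<in> {0<..<1}" and x: "x \<in> {0..1/2}"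
  shows "emeasure type_law (entrants p \<inter> {z. snd z * fst z < x})
    = ennreal (premium_cdf p x * (1 - F_beta p))"
proof -
  interpret U: prob_space "uniform_measure lborel {0..1/2::real}"
    by (rule prob_space_uniform_half)
  let ?U = "uniform_measure lborel {0..1/2::real}"
  let ?X = "entrants p \<inter> {z. snd z * fst z < x}"
  define a where "a = max p (2 * x)"
  have a: "p \<le> a" "a \<le> 1" "2 * x \<le> a" using p x by (auto simp: a_def)
  have "{z. snd z * fst z < x} = {z \<in> space (borel \<Otimes>\<^sub>M borel). snd z * fst z < x}"
    by (simp add: space_pair_measure)
  also have "\<dots> \<in> sets (borel \<Otimes>\<^sub>M borel)" by measurable
  finally have X: "?X \<in> sets (borel \<Otimes>\<^sub>M borel)"
    using entrants_measurable[OF p] by (rule sets.Int[rotated])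
  have "emeasure type_law ?X = (\<integral>\<^sup>+ V. emeasure ?U (Pair V -` ?X) \<partial>beta_distribution 2 2)"
    unfolding type_law_def
    by (rule U.emeasure_pair_measure_alt)
       (use X in \<open>simp add: beta_distribution_def cong: sets_pair_measure_cong\<close>)
  also have "\<dots> = (\<integral>\<^sup>+ V. ennreal (min 1 (2 * (x / V))) * indicator {p<..1} V \<partial>beta_distribution 2 2)"
  proof (rule nn_integral_cong)
    fix V
    show "emeasure ?U (Pair V -` ?X) = ennreal (min 1 (2 * (x / V))) * indicator {p<..1} V"
    proof (cases "V \<in> {p<..1}")
      case True
      then have "emeasure ?U (Pair V -` ?X) = emeasure ?U ({0..1/2} \<inter> {0..<x / V})"
        using p by (intro arg_cong[where f = "emeasure ?U"])
          (auto simp: entrants_eq types_def field_simps)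
      also have "\<dots> = emeasure ?U {0..<x / V}" by simp
      also have "\<dots> = ennreal (min 1 (2 * (x / V)))"
        using True p x by (intro emeasure_uniform_half) auto
      finally show ?thesis using True by simp
    next
      case False
      then have "Pair V -` ?X = {}" using p by (auto simp: entrants_eq types_def)
      then show ?thesis using False by (simp del: vimage_Int)
    qed
  qed
  also have "\<dots> = (\<integral>\<^sup>+ V. ennreal (beta_density 2 2 V) *
      (ennreal (min 1 (2 * (x / V))) * indicator {p<..1} V) \<partial>lborel)"
    unfolding beta_distribution_def
    by (subst nn_integral_density) (auto simp: beta_density_2_2[abs_def])
  also have "\<dots> = (\<integral>\<^sup>+ V. ennreal (6 * V * (1 - V)) * indicator {p..a} V
      + ennreal (12 * x * (1 - V)) * indicator {a..1} V \<partial>lborel)"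
  proof (rule nn_integral_cong_AE)
    \<comment> \<open>Off these three points the closed intervals suited to the fundamental theorem
      replace (p, 1], and their overlap at \<open>a\<close> is not counted twice.\<close>
    have "AE V in lborel. V \<noteq> p \<and> V \<noteq> a \<and> V \<noteq> (1::real)"
      by (intro AE_conjI AE_lborel_singleton)
    then show "AE V in lborel. ennreal (beta_density 2 2 V) *
        (ennreal (min 1 (2 * (x / V))) * indicator {p<..1} V)
      = ennreal (6 * V * (1 - V)) * indicator {p..a} V
        + ennreal (12 * x * (1 - V)) * indicator {a..1} V"
    proof eventually_elim
      case (elim V)
      consider "V < p \<or> 1 < V" | "p < V" "V < a" | "a < V" "V < 1"
        using elim a by linarith
      then show ?case
      proof cases
        case 1
        then show ?thesis using a by (auto simp: indicator_def)
      next
        case 2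
        then have "min 1 (2 * (x / V)) = 1" using p by (simp add: a_def field_simps max_def split: if_splits)
        then show ?thesis using 2 a p by (simp add: beta_density_2_2)
      next
        case 3
        then have "min 1 (2 * (x / V)) = 2 * (x / V)" using p x a by (simp add: field_simps)
        moreover have "6 * V * (1 - V) * (2 * (x / V)) = 12 * x * (1 - V)"
          using 3 a p by (simp add: field_simps)
        ultimately show ?thesis using 3 a p x
          by (simp add: beta_density_2_2 flip: ennreal_mult)
      qed
    qed
  qed
  also have "\<dots> = (\<integral>\<^sup>+ V. ennreal (6 * V * (1 - V)) * indicator {p..a} V \<partial>lborel)
      + (\<integral>\<^sup>+ V. ennreal (12 * x * (1 - V)) * indicator {a..1} V \<partial>lborel)"
    by (rule nn_integral_add) auto
  also have "(\<integral>\<^sup>+ V. ennreal (6 * V * (1 - V)) * indicator {p..a} V \<partial>lborel)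
      = ennreal (F_beta a - F_beta p)"
    using p a
    by (intro nn_integral_FTC_Icc)
       (auto simp: F_beta_def algebra_simps power2_eq_square mult_left_le
             intro!: derivative_eq_intros mult_left_le)
  also have "(\<integral>\<^sup>+ V. ennreal (12 * x * (1 - V)) * indicator {a..1} V \<partial>lborel)
      = ennreal (- (6 * x * (1 - 1)^2) - - (6 * x * (1 - a)^2))"
    using a x
    by (intro nn_integral_FTC_Icc)
       (auto simp: algebra_simps mult_left_le_one_le intro!: derivative_eq_intros)
  also have "ennreal (F_beta a - F_beta p) + \<dots> = ennreal (premium_cdf p x * (1 - F_beta p))"
    using p x a F_beta_less_one[OF p] F_beta_mono[of p a]
    by (simp add: premium_cdf_def flip: a_def ennreal_plus)
  finally show ?thesis .
qed

lemma emeasure_entrants: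
  assumes p: "p \<in> {0<..<1}"
  shows "emeasure type_law (entrants p) = ennreal (1 - F_beta p)"
proof -
  interpret U: prob_space "uniform_measure lborel {0..1/2::real}"
    by (rule prob_space_uniform_half)
  have "entrants p = {p<..1} \<times> {0..1/2}"
    using p unfolding entrants_eq[OF p] types_def by auto
  then have "emeasure type_law (entrants p) = emeasure (beta_distribution 2 2) {p<..1}"
    using emeasure_uniform_measure_1[of lborel "{0..1/2::real}"]
    unfolding type_law_def
    by (simp add: U.emeasure_pair_measure_Times beta_distribution_def)
  also have "\<dots> = (\<integral>\<^sup>+ V. ennreal (6 * V * (1 - V)) * indicator {p..1} V \<partial>lborel)"
    unfolding beta_distribution_def
  proof (subst emeasure_density)
    have "AE V in lborel. V \<noteq> p \<and> V \<noteq> (1::real)"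
      by (intro AE_conjI AE_lborel_singleton)
    then show "(\<integral>\<^sup>+ V. ennreal (beta_density 2 2 V) * indicator {p<..1} V \<partial>lborel)
        = (\<integral>\<^sup>+ V. ennreal (6 * V * (1 - V)) * indicator {p..1} V \<partial>lborel)"
      by (intro nn_integral_cong_AE, elim eventually_mono)
        (use p in \<open>auto simp: beta_density_2_2 indicator_def\<close>)
  qed (auto simp: beta_density_2_2[abs_def])
  also have "\<dots> = ennreal (F_beta 1 - F_beta p)"
    using p
    by (intro nn_integral_FTC_Icc)
       (auto simp: F_beta_def algebra_simps power2_eq_square mult_left_le
             intro!: derivative_eq_intros)
  finally show ?thesis by (simp add: F_beta_def)
qed

lemma prob_space_rival_law: "p \<in> {0<..<1} \<Longrightarrow> prob_space (rival_law p)"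
  unfolding rival_law_def
  by (rule prob_space_uniform_measure) (use F_beta_less_one[of p] in \<open>simp_all add: emeasure_entrants\<close>)

lemma sets_rival_law [measurable_cong]: "sets (rival_law p) = sets (borel \<Otimes>\<^sub>M borel)"
  by (simp add: rival_law_def sets_type_law)

lemma space_rival_law: "space (rival_law p) = UNIV"
  by (simp add: rival_law_def space_type_law)

lemma AE_rival_law_entrants:
  assumes "p \<in> {0<..<1}"
  shows "AE z in rival_law p. z \<in> entrants p"
  unfolding rival_law_def
  by (rule AE_uniform_measureI) (simp_all add: sets_type_law entrants_measurable[OF assms])

lemma measure_rival_law_premium:
  assumes p: "p \<in> {0<..<1}" and x: "x \<in> {0..1/2}"
  shows "measure (rival_law p) {z. snd z * fst z < x} = premium_cdf p x"
proof -
  have D: "0 < 1 - F_beta p" using F_beta_less_one[OF p] by simp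
  \<comment> \<open>\<open>ennreal\<close> sends negative reals to 0, so passing from
    \<open>emeasure\<close> to \<open>measure\<close> requires this sign.\<close>
  have "0 \<le> premium_cdf p x"
    using strict_mono_on_leD[OF premium_cdf_strict_mono_on[OF p], of 0 x] x p
    by (simp add: premium_cdf_le)
  then have "measure type_law (entrants p \<inter> {z. snd z * fst z < x}) = premium_cdf p x * (1 - F_beta p)"
    using emeasure_entrants_premium[OF p x] D by (simp add: measure_def)
  moreover have "measure type_law (entrants p) = 1 - F_beta p"
    using emeasure_entrants[OF p] D by (simp add: measure_def)
  moreover have "{z. snd z * fst z < x} \<in> sets type_law"
  proof -
    have "{z. snd z * fst z < x} = {z \<in> space type_law. snd z * fst z < x}"
      by (simp add: space_type_law)
    also have "\<dots> \<in> sets type_law" by measurable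
    finally show ?thesis .
  qed
  ultimately show ?thesis
    using D unfolding rival_law_def
    by (subst measure_uniform_measure) (simp_all add: emeasure_entrants[OF p])
qed

section \<open>Expected utility in each range of bids\<close>

lemma expected_utility_below:
  assumes "p \<in> {0<..<1}" "b < p"
  shows "expected_utility p \<sigma> vd vp b = - b"
proof -
  interpret prob_space "rival_law p" using assms(1) by (rule prob_space_rival_law)
  show ?thesis using assms(2) by (simp add: expected_utility_def utility_def case_prod_unfold prob_space)
qed

lemma expected_utility_one:
  assumes "p \<in> {0<..<1}"
  shows "expected_utility p \<sigma> vd vp 1 = vd + vp - 1"
proof -
  interpret prob_space "rival_law p" using assms by (rule prob_space_rival_law)
  show ?thesis using assms by (simp add: expected_utility_def utility_def case_prod_unfold prob_space)
qed

text \<open>For b < 1 truncating the rival's bid at 1 does not change whether it lies below b, so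
  \<open>bid_hat\<close> can replace \<open>bid_star\<close> in the winning event.\<close>

lemma expected_utility_mid:
  assumes p: "p \<in> {0<..<1}" and b: "p \<le> b" "b < 1"
  shows "expected_utility p (bid_star p) vd vp b
    = vd - b + vp * measure (rival_law p) {z. bid_hat p (snd z * fst z) < b}"
proof -
  interpret prob_space "rival_law p" using p by (rule prob_space_rival_law)
  let ?A = "{z. bid_hat p (snd z * fst z) < b}"
  have "?A = {z \<in> space (rival_law p). bid_star p ((1 - snd z) * fst z) (snd z * fst z) < b}"
    using b by (auto simp: space_rival_law bid_star_def)
  also have "\<dots> \<in> sets (rival_law p)"
    unfolding bid_star_def bid_hat_def by measurable
  finally have A: "?A \<in> sets (rival_law p)" .
  have "expected_utility p (bid_star p) vd vp b = (\<integral>z. (vd - b) + vp * indicator ?A z \<partial>rival_law p)"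
    unfolding expected_utility_def
    using b by (intro Bochner_Integration.integral_cong)
      (auto simp: utility_def bid_star_def indicator_def)
  also have "\<dots> = vd - b + vp * measure (rival_law p) ?A"
    using A by (subst Bochner_Integration.integral_add)
      (auto simp: prob_space less_top[symmetric])
  finally show ?thesis .
qed

text \<open>Comparing bids amounts to comparing premium values. This holds only almost surely,
  because \<open>bid_hat\<close> is known to increase just on [0, 1/2], where the premium values of
  entrants lie.\<close>

lemma expected_utility_bid_hat:
  assumes p: "p \<in> {0<..<1}" and x: "x \<in> {0..1/2}" and B: "bid_hat p x < 1"
  shows "expected_utility p (bid_star p) vd vp (bid_hat p x)
    = vd + vp * premium_cdf p x - bid_hat p x"
proof -
  interpret prob_space "rival_law p" using p by (rule prob_space_rival_law)
  note mono = bid_hat_strict_mono_on[OF p]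
  have "p \<le> bid_hat p x"
    using strict_mono_on_leD[OF mono, of 0 x] x by (simp add: bid_hat_0[OF p])
  moreover have "measure (rival_law p) {z. bid_hat p (snd z * fst z) < bid_hat p x}
      = measure (rival_law p) {z. snd z * fst z < x}"
  proof (rule measure_eq_AE)
    show "AE z in rival_law p. z \<in> {z. bid_hat p (snd z * fst z) < bid_hat p x}
        \<longleftrightarrow> z \<in> {z. snd z * fst z < x}"
      using AE_rival_law_entrants[OF p]
    proof eventually_elim
      case (elim z)
      then have "snd z * fst z \<in> {0..1/2}"
        using mult_mono[of "snd z" "1/2" "fst z" 1] p by (auto simp: entrants_eq types_def)
      then show ?case using strict_mono_on_less[OF mono _ x] by auto
    qed
  next
    have "{z. bid_hat p (snd z * fst z) < bid_hat p x}
        = {z \<in> space (rival_law p). bid_hat p (snd z * fst z) < bid_hat p x}"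
      by (simp add: space_rival_law)
    also have "\<dots> \<in> sets (rival_law p)"
      unfolding bid_hat_def by measurable
    finally show "{z. bid_hat p (snd z * fst z) < bid_hat p x} \<in> sets (rival_law p)" .
    have "{z. snd z * fst z < x} = {z \<in> space (rival_law p). snd z * fst z < x}"
      by (simp add: space_rival_law)
    also have "\<dots> \<in> sets (rival_law p)" by measurable
    finally show "{z. snd z * fst z < x} \<in> sets (rival_law p)" .
  qed
  ultimately show ?thesis
    using expected_utility_mid[OF p _ B, of vd vp] measure_rival_law_premium[OF p x] by simp
qed

text \<open>
  A bid in \<open>[p, 1)\<close> is the bid \<open>bid_hat p x\<close> of some rival or exceeds them all, in which case
  bidding \<open>bid_hat p (1/2)\<close> already wins almost surely.
\<close>

lemma expected_utility_mid_le:
  assumes p: "p \<in> {0<..<1}" and b: "p \<le> b" "b < 1" and y: "y \<in> {0..1/2}"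
  shows "expected_utility p (bid_star p) vd y b \<le> vd + y * premium_cdf p y - bid_hat p y"
proof (cases "b \<le> bid_hat p (1/2)")
  case True
  have "continuous_on {0..1/2} (bid_hat p)"
    using continuous_on_bid_hat[OF p] continuous_on_subset by blast
  then obtain x where x: "x \<in> {0..1/2}" "bid_hat p x = b"
    using IVT'[of "bid_hat p" 0 b "1/2"] True b bid_hat_0[OF p] by auto
  then show ?thesis
    using expected_utility_bid_hat[OF p, of x vd y] bid_hat_tangent[OF p x(1) y] b by simp
next
  case False
  interpret prob_space "rival_law p" using p by (rule prob_space_rival_law)
  have "y * measure (rival_law p) {z. bid_hat p (snd z * fst z) < b} \<le> y * 1"
    using y by (intro mult_left_mono) auto
  then show ?thesis
    using expected_utility_mid[OF p b, of vd y] bid_hat_tangent[OF p _ y, of "1/2"] False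
    by (simp add: premium_cdf_half[OF p])
qed

section \<open>Participation and optimality\<close>

text \<open>A profitable bid lies in [p, 1), since lower bids earn at most 0 and the bid 1 earns
  \<open>vd + y - 1\<close>. Hence the bound for that range is positive, and as
  \<open>premium_cdf\<close> is at most 1, \<open>bid_hat p y\<close> stays below
  \<open>vd + y\<close>.\<close>

lemma participates_bid_hat_less_one:
  assumes p: "p \<in> {0<..<1}" and y: "y \<in> {0..1/2}" and V: "vd + y \<le> 1"
    and part: "participates p (bid_star p) vd y"
  shows "bid_hat p y < 1" and "0 < vd + y * premium_cdf p y - bid_hat p y"
proof -
  obtain b where b: "b \<in> {0..1}" "0 < expected_utility p (bid_star p) vd y b"
    using part by (auto simp: participates_def)
  then have "\<not> b < p" "b \<noteq> 1"
    using expected_utility_below[OF p, of b] expected_utility_one[OF p] V by force+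
  then show pos: "0 < vd + y * premium_cdf p y - bid_hat p y"
    using expected_utility_mid_le[OF p _ _ y, of b vd] b by auto
  have "premium_cdf p y \<le> 1"
    using strict_mono_on_leD[OF premium_cdf_strict_mono_on[OF p], of y "1/2"] y
    by (simp add: premium_cdf_half[OF p])
  then have "y * premium_cdf p y \<le> y"
    using y by (simp add: mult_left_le)
  then show "bid_hat p y < 1" using pos V by linarith
qed

text \<open>Deviations below p or to 1 earn at most 0, less than the positive equilibrium utility;
  those in between are covered by \<open>expected_utility_mid_le\<close>.\<close>

lemma optimal_bid_star:
  assumes p: "p \<in> {0<..<1}" and y: "y \<in> {0..1/2}" and V: "vd + y \<le> 1"
    and part: "participates p (bid_star p) vd y"
  shows "optimal_bid p (bid_star p) vd y (bid_star p vd y)"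
    and "0 < expected_utility p (bid_star p) vd y (bid_star p vd y)"
proof -
  note B = participates_bid_hat_less_one[OF assms]
  have "p \<le> bid_hat p y"
    using strict_mono_on_leD[OF bid_hat_strict_mono_on[OF p], of 0 y] y by (simp add: bid_hat_0[OF p])
  moreover have star: "bid_star p vd y = bid_hat p y" using B by (simp add: bid_star_def)
  moreover have u: "expected_utility p (bid_star p) vd y (bid_hat p y)
      = vd + y * premium_cdf p y - bid_hat p y"
    by (rule expected_utility_bid_hat[OF p y B(1)])
  moreover have "expected_utility p (bid_star p) vd y b \<le> vd + y * premium_cdf p y - bid_hat p y"
    if b: "b \<in> {0..1}" for b
  proof -
    consider "b < p" | "p \<le> b" "b < 1" | "b = 1" using b by fastforce
    then show ?thesis
      by cases (use b B(2) V expected_utility_below[OF p] expected_utility_one[OF p]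
          expected_utility_mid_le[OF p _ _ y] in force)+
  qed
  ultimately show "optimal_bid p (bid_star p) vd y (bid_star p vd y)"
    and "0 < expected_utility p (bid_star p) vd y (bid_star p vd y)"
    using B p by (auto simp: optimal_bid_def)
qed

theorem corollary2:
  fixes M :: "real \<Rightarrow> real" and \<epsilon> p :: real
  assumes "M \<in> {0<..<1} \<rightarrow> {0<..<1}"
    and "strict_mono_on {0<..<1} M"
    and "\<epsilon> \<in> {0<..<1}"
    and "p = M \<epsilon>"
  shows "symmetric_equilibrium p (bid_star p) \<and>
    (\<forall>V\<in>{0..1}. \<forall>l\<in>{0..1/2}.
       let vd = (1 - l) * V; vp = l * V; b = bid_star p vd vp;
           u = expected_utility p (bid_star p) vd vp b;
           s = recorded_compliance M (submitted_bid p (bid_star p) vd vp)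
       in (participates p (bid_star p) vd vp \<or> b < 1 \<longrightarrow>
             (vp \<le> p / 2 \<longrightarrow>
                u = vd + 6 * vp^2 * (p^2 - 2 * p + 1) / (1 - F_beta p) - b) \<and>
             (p / 2 \<le> vp \<longrightarrow>
                u = vd + vp * (8 * vp^3 - 12 * vp^2 + 6 * vp + p^2 * (2 * p - 3)) / (1 - F_beta p) - b)) \<and>
          s = (if u > 0 then compliance_level M b else 0) \<and>
          (u > 0 \<and> b \<in> M ` {0<..<1} \<longrightarrow> \<epsilon> \<le> s \<and> (0 < vp \<longrightarrow> \<epsilon> < s)))"
proof -
  have p: "p \<in> {0<..<1}" using assms by auto
  have range: "l * V \<in> {0..1/2}" "(1 - l) * V + l * V \<le> 1"
    if "V \<in> {0..1}" "l \<in> {0..1/2}" for V l :: real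
    using that mult_mono[of l "1/2" V 1] by (auto simp: algebra_simps)
  have "symmetric_equilibrium p (bid_star p)"
    unfolding symmetric_equilibrium_def types_def Let_def
    using optimal_bid_star(1)[OF p range] by auto
  moreover have "(participates p (bid_star p) vd y \<or> b < 1 \<longrightarrow>
        (y \<le> p / 2 \<longrightarrow> u = vd + 6 * y^2 * (p^2 - 2 * p + 1) / (1 - F_beta p) - b) \<and>
        (p / 2 \<le> y \<longrightarrow>
          u = vd + y * (8 * y^3 - 12 * y^2 + 6 * y + p^2 * (2 * p - 3)) / (1 - F_beta p) - b)) \<and>
      s = (if u > 0 then compliance_level M b else 0) \<and>
      (u > 0 \<and> b \<in> M ` {0<..<1} \<longrightarrow> \<epsilon> \<le> s \<and> (0 < y \<longrightarrow> \<epsilon> < s))"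
    if y: "y \<in> {0..1/2}" and V: "vd + y \<le> 1" and b: "b = bid_star p vd y"
      and u: "u = expected_utility p (bid_star p) vd y b"
      and s: "s = recorded_compliance M (submitted_bid p (bid_star p) vd y)" for vd y b u s
  proof (intro conjI)
    show "participates p (bid_star p) vd y \<or> b < 1 \<longrightarrow>
        (y \<le> p / 2 \<longrightarrow> u = vd + 6 * y^2 * (p^2 - 2 * p + 1) / (1 - F_beta p) - b) \<and>
        (p / 2 \<le> y \<longrightarrow>
          u = vd + y * (8 * y^3 - 12 * y^2 + 6 * y + p^2 * (2 * p - 3)) / (1 - F_beta p) - b)"
    proof
      assume "participates p (bid_star p) vd y \<or> b < 1"
      then have B: "bid_hat p y < 1"
        using participates_bid_hat_less_one(1)[OF p y V] b by (auto simp: bid_star_def)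
      then have "b = bid_hat p y" by (simp add: b bid_star_def)
      then have "u = vd + y * premium_cdf p y - b"
        using u expected_utility_bid_hat[OF p y B] by simp
      then show "(y \<le> p / 2 \<longrightarrow> u = vd + 6 * y^2 * (p^2 - 2 * p + 1) / (1 - F_beta p) - b) \<and>
        (p / 2 \<le> y \<longrightarrow>
          u = vd + y * (8 * y^3 - 12 * y^2 + 6 * y + p^2 * (2 * p - 3)) / (1 - F_beta p) - b)"
        by (auto simp: premium_cdf_le premium_cdf_ge power2_eq_square mult.assoc mult.left_commute)
    qed
    have mono: "p \<le> bid_hat p y" "0 < y \<Longrightarrow> p < bid_hat p y"
      using strict_mono_on_leD[OF bid_hat_strict_mono_on[OF p], of 0 y]
        strict_mono_onD[OF bid_hat_strict_mono_on[OF p], of 0 y] y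
      by (simp_all add: bid_hat_0[OF p])
    then have pb: "p \<le> b" "0 < y \<Longrightarrow> p < b" "b \<le> 1"
      using p by (auto simp: b bid_star_def)
    have "participates p (bid_star p) vd y \<longleftrightarrow> u > 0"
    proof
      show "u > 0" if "participates p (bid_star p) vd y"
        using optimal_bid_star(2)[OF p y V that] by (simp add: u b)
      show "participates p (bid_star p) vd y" if "u > 0"
        using that pb p by (auto simp: participates_def u intro!: bexI[of _ b])
    qed
    then show s': "s = (if u > 0 then compliance_level M b else 0)"
      \<comment> \<open>Since b is at least p > 0, an actual submission is never mistaken for the
        bid 0 that encodes abstention.\<close>
      using pb p by (auto simp: s recorded_compliance_def submitted_bid_def b)
    show "u > 0 \<and> b \<in> M ` {0<..<1} \<longrightarrow> \<epsilon> \<le> s \<and> (0 < y \<longrightarrow> \<epsilon> < s)"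
    proof
      assume "u > 0 \<and> b \<in> M ` {0<..<1}"
      \<comment> \<open>M may jump, so b could miss its range; for b = M t injectivity gives s = t,
        and comparing M t with p = M \<epsilon> compares t with \<epsilon>. At premium 0 the bid is
        p itself, hence the weak inequality.\<close>
      then obtain t where t: "t \<in> {0<..<1}" "b = M t" and "u > 0" by auto
      then have "s = t"
        using s' the_inv_into_f_f[OF strict_mono_on_imp_inj_on[OF assms(2)]]
        by (simp add: compliance_level_def)
      then show "\<epsilon> \<le> s \<and> (0 < y \<longrightarrow> \<epsilon> < s)"
        using pb t assms(4) strict_mono_on_less[OF assms(2) assms(3) t(1)]
          strict_mono_on_less_eq[OF assms(2) assms(3) t(1)] by simp
    qed
  qed
  ultimately show ?thesis
    unfolding Let_def using range by blast
qed

end
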